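(* For every fixed integer $A\geq 2$, there is an integer $t_A$ such that, for every integer $t\geq t_A$, there exists a $K_t$-minor-free graph $G$ with $d(G)\geq At$ such that every $t$-connected subgraph $H$ of $G$ satisfies $$v(H)>\frac{1}{7200\,\mathrm{e}\,A^2}\,t\log t.$$
   Context: All graphs are finite and simple. For a graph $G$, $v(G)=|V(G)|$ and $e(G)=|E(G)|$ denote its numbers of vertices and edges. For a nonempty graph $G$ (one with at least one vertex), its density is $d(G)=e(G)/v(G)$; in particular the graph $G$ in the claim is nonempty. The logarithm $\log$ is natural and $\mathrm{e}$ is the base of the natural logarithm. $K_t$ denotes the complete graph on $t$ vertices. A graph $G$ is $K_t$-minor-free if $K_t$ is not a minor of $G$; equivalently, there do not exist pairwise disjoint nonempty sets $B_1,\ldots,B_t\subseteq V(G)$ such that each induced subgraph $G[B_i]$ is connected and, for all $i\neq j$, some edge of $G$ joins $B_i$ to $B_j$. Subgraphs are not required to be induced. A graph $H$ is $t$-connected if its vertex connectivity satisfies $\kappa(H)\geq t$, in the usual sense: $v(H)\geq t+1$ and deleting any set of fewer than $t$ vertices leaves a connected graph. *)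

theory Defs
  imports Complex_Main "HOL-Library.Disjoint_Sets" "Graph_Theory.Graph_Theory"
begin

text \<open>
  A finite simple graph is a \<^locale>\<open>pair_graph\<close>: a finite symmetric loopfree digraph whose arcs are
  pairs of vertices. Each undirected edge is thus represented by two arcs, and it is counted once
  below by passing to unordered pairs.
\<close>

definition num_vertices :: "'a pair_pre_digraph \<Rightarrow> nat" where
  "num_vertices G = card (pverts G)"

definition num_edges :: "'a pair_pre_digraph \<Rightarrow> nat" where
  "num_edges G = card {{u, v} | u v. (u, v) \<in> parcs G}"

definition graph_density :: "'a pair_pre_digraph \<Rightarrow> real" where
  "graph_density G = real (num_edges G) / real (num_vertices G)"

text \<open>
  Minors are given by branch sets. The connectedness predicate is the graph-theoretic one, not the
  topological one of the same name; it implies nonemptiness.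
\<close>

definition graph_minor :: "'b pair_pre_digraph \<Rightarrow> 'a pair_pre_digraph \<Rightarrow> bool" where
  "graph_minor H G \<longleftrightarrow> (\<exists>B :: 'b \<Rightarrow> 'a set.
     (\<forall>x \<in> pverts H. B x \<noteq> {} \<and> B x \<subseteq> pverts G \<and>
        Digraph_Component.connected (with_proj G \<restriction> B x)) \<and>
     disjoint_family_on B (pverts H) \<and>
     (\<forall>(x, y) \<in> parcs H. \<exists>u \<in> B x. \<exists>v \<in> B y. (u, v) \<in> parcs G))"

definition clique_minor_free :: "nat \<Rightarrow> 'a pair_pre_digraph \<Rightarrow> bool" where
  "clique_minor_free t G \<longleftrightarrow>
     \<not> (\<exists>K :: nat pair_pre_digraph. complete_digraph t (with_proj K) \<and> graph_minor K G)"

definition vertex_connected :: "nat \<Rightarrow> 'a pair_pre_digraph \<Rightarrow> bool" where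
  "vertex_connected t H \<longleftrightarrow>
     num_vertices H \<ge> t + 1 \<and>
     (\<forall>S. S \<subseteq> pverts H \<and> card S < t \<longrightarrow>
        Digraph_Component.connected (with_proj H \<restriction> (pverts H - S)))"

text \<open>
  The library's \<^const>\<open>subgraph\<close> also admits subdigraphs that are not symmetric, so the subgraph is
  required to be a graph itself.
\<close>

definition simple_subgraph :: "'a pair_pre_digraph \<Rightarrow> 'a pair_pre_digraph \<Rightarrow> bool" where
  "simple_subgraph H G \<longleftrightarrow> pair_graph H \<and> subgraph (with_proj H) (with_proj G)"

end

theory Submission
  imports Defs "HOL-Probability.Product_PMF" "HOL-Real_Asymp.Real_Asymp"
begin

text \<open>
  The graph is a binomial random graph on \<open>n\<close> vertices with edge probability \<open>p\<close>, where
  \<open>n\<close> is about \<open>t ln t / (450 A)\<close> and \<open>p = 8 A t / n\<close>. Its expected density is about \<open>4 A t\<close>. Two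
  kinds of accidents have to be excluded.

  A \<open>K\<^sub>t\<close>-minor would provide \<open>t\<close> disjoint vertex sets, pairwise joined by edges. Half of them have at
  most \<open>2 n / t\<close> vertices, a small multiple of \<open>ln t\<close>. Because \<open>p\<close> is of order \<open>1 / ln t\<close>, two such sets
  are non-adjacent with probability at least \<open>1 / \<surd>t\<close>. So all of the roughly \<open>t\<^sup>2 / 8\<close> pairs are joined
  with probability \<open>exp (- \<Omega> (t\<^sup>2 / \<surd>t))\<close>, which is negligible against the \<open>(t + 1) ^ n\<close>, that is
  \<open>exp (O (t ln\<^sup>2 t))\<close>, ways of choosing the sets (\<open>prob_bags_pairwise_joined\<close>).

  A \<open>t\<close>-connected subgraph \<open>H\<close> has minimum degree at least \<open>t\<close>, hence at least \<open>t v(H) / 2\<close> edges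
  (\<open>vertex_connected_num_edges\<close>). A set of \<open>m\<close> vertices is expected to span only about \<open>p m\<^sup>2 / 2\<close> edges,
  and for \<open>m\<close> up to \<open>t ln t / (7200 e A\<^sup>2)\<close> this falls short of \<open>t m / 2\<close> by a factor of at least \<open>2 e\<close>.
  For \<open>m > t\<close> the upper tail is then at most \<open>2 ^ (- t\<^sup>2 / 2)\<close>, negligible
  against the \<open>2 ^ n\<close> vertex sets (\<open>prob_dense_vertex_subset\<close>).

  Both accidents together have probability below \<open>p / 2\<close>, so some accident-free outcome has at least half of the
  expected number of edges (\<open>exists_good_edge_set\<close>), and it is the required graph.
\<close>

section \<open>Simple graphs as sets of two-element edges\<close>

definition edge_pairs :: "'a set \<Rightarrow> 'a set set" where
  "edge_pairs V = {e. e \<subseteq> V \<and> card e = 2}"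

definition graph_on :: "'a set \<Rightarrow> 'a set set \<Rightarrow> 'a pair_pre_digraph" where
  "graph_on V F = \<lparr>pverts = V, parcs = {(u, v). {u, v} \<in> F}\<rparr>"

lemma graph_on_simps [simp]:
  "pverts (graph_on V F) = V" "parcs (graph_on V F) = {(u, v). {u, v} \<in> F}"
  by (simp_all add: graph_on_def)

lemma finite_edge_pairs [simp]: "finite V \<Longrightarrow> finite (edge_pairs V)"
  by (simp add: edge_pairs_def)

lemma card_edge_pairs: "finite V \<Longrightarrow> card (edge_pairs V) = card V choose 2"
  by (simp add: edge_pairs_def n_subsets)

lemma edge_pairs_mono: "X \<subseteq> V \<Longrightarrow> edge_pairs X \<subseteq> edge_pairs V"
  by (auto simp: edge_pairs_def)

lemma mem_edge_pairs_iff [simp]: "{u, v} \<in> edge_pairs V \<longleftrightarrow> u \<in> V \<and> v \<in> V \<and> u \<noteq> v"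
  by (cases "u = v") (auto simp: edge_pairs_def)

lemma edge_pairsE:
  assumes "e \<in> edge_pairs V"
  obtains u v where "e = {u, v}" "u \<in> V" "v \<in> V" "u \<noteq> v"
  using assms by (auto simp: edge_pairs_def card_2_iff)

lemma pair_graph_graph_on:
  assumes "finite V" "F \<subseteq> edge_pairs V"
  shows "pair_graph (graph_on V F)"
proof -
  have arcD: "u \<in> V \<and> v \<in> V \<and> u \<noteq> v" if "{u, v} \<in> F" for u v
    using subsetD[OF assms(2) that] by simp
  have "parcs (graph_on V F) \<subseteq> V \<times> V"
    using arcD by auto
  then have fin: "finite (parcs (graph_on V F))"
    using assms(1) by (meson finite_SigmaI finite_subset)
  show ?thesis
    by unfold_locales (use fin assms arcD in \<open>auto simp: symmetric_def sym_def insert_commute\<close>)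
qed

lemma num_edges_graph_on:
  assumes "F \<subseteq> edge_pairs V"
  shows "num_edges (graph_on V F) = card F"
proof -
  have "{{u, v} | u v. (u, v) \<in> parcs (graph_on V F)} = F" (is "?E = F")
  proof
    show "?E \<subseteq> F" by auto
    show "F \<subseteq> ?E"
    proof
      fix e assume e: "e \<in> F"
      then have "e \<in> edge_pairs V" using assms by blast
      then obtain u v where "e = {u, v}" by (rule edge_pairsE)
      with e show "e \<in> ?E" by auto
    qed
  qed
  then show ?thesis by (simp add: num_edges_def)
qed

text \<open>
  The branch sets of a \<open>K\<^sub>t\<close>-minor label the vertices by \<open>0, \<dots>, t\<close>, where the label \<open>t\<close> marks a
  vertex in no branch set. Every two labels below \<open>t\<close> then occur on the two ends of some edge, that is,
  they form the image of an edge. The union bound later runs over these labellings.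
\<close>
lemma clique_minor_free_graph_on:
  fixes V :: "'a set"
  assumes missing: "\<And>\<phi>. \<phi> \<in> V \<rightarrow>\<^sub>E {..t} \<Longrightarrow> \<exists>d \<in> edge_pairs {..<t}. \<forall>e\<in>F. \<phi> ` e \<noteq> d"
  shows "clique_minor_free t (graph_on V F)"
  unfolding clique_minor_free_def
proof
  assume "\<exists>K::nat pair_pre_digraph. complete_digraph t (with_proj K) \<and> graph_minor K (graph_on V F)"
  then obtain K :: "nat pair_pre_digraph" where
    complete: "complete_digraph t (with_proj K)" and minor: "graph_minor K (graph_on V F)"
    by blast
  have K: "finite (pverts K)" "card (pverts K) = t"
       "parcs K = {(u,v). (u,v) \<in> pverts K \<times> pverts K \<and> u \<noteq> v}"
    using complete by (simp_all add: complete_digraph_pair_def)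
  obtain B :: "nat \<Rightarrow> 'a set" where
    sub: "\<And>x. x \<in> pverts K \<Longrightarrow> B x \<subseteq> V"
    and disj: "disjoint_family_on B (pverts K)"
    and edge: "\<forall>(x, y) \<in> parcs K. \<exists>u \<in> B x. \<exists>v \<in> B y. (u, v) \<in> parcs (graph_on V F)"
    using minor unfolding graph_minor_def graph_on_simps by meson
  obtain h where h: "bij_betw h (pverts K) {..<t}"
    using K(1,2) by (metis ex_bij_betw_finite_nat atLeast0LessThan)
  define \<phi> where "\<phi> = (\<lambda>v\<in>V. if \<exists>x\<in>pverts K. v \<in> B x then h (THE x. x \<in> pverts K \<and> v \<in> B x) else t)"
  have \<phi>_eq: "\<phi> v = h x" if "x \<in> pverts K" "v \<in> B x" for x v
  proof -
    have "(THE x. x \<in> pverts K \<and> v \<in> B x) = x"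
      using that disj by (intro the_equality) (auto simp: disjoint_family_on_def)
    then show ?thesis using that sub by (auto simp: \<phi>_def)
  qed
  have hlt: "h x < t" if "x \<in> pverts K" for x
    using bij_betwE[OF h] that by auto
  have "\<phi> v \<le> t" if "v \<in> V" for v
  proof (cases "\<exists>x\<in>pverts K. v \<in> B x")
    case True
    then show ?thesis using \<phi>_eq hlt by (metis less_imp_le)
  next
    case False
    then show ?thesis using that by (simp add: \<phi>_def)
  qed
  then have "\<phi> \<in> V \<rightarrow>\<^sub>E {..t}"
    by (auto simp: \<phi>_def)
  then obtain d where d: "d \<in> edge_pairs {..<t}" "\<forall>e\<in>F. \<phi> ` e \<noteq> d"
    using missing[of \<phi>] by metis
  then obtain i j where ij: "d = {i, j}" "i < t" "j < t" "i \<noteq> j"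
    by (metis edge_pairsE lessThan_iff)
  obtain x y where xy: "x \<in> pverts K" "h x = i" "y \<in> pverts K" "h y = j"
    using h ij by (metis bij_betw_imp_surj_on imageE lessThan_iff)
  then have "(x, y) \<in> parcs K" using ij K(3) by auto
  then obtain u v where "u \<in> B x" "v \<in> B y" "{u, v} \<in> F"
    using edge by auto
  then show False
    using d(2) \<phi>_eq xy ij(1) by (metis image_insert image_empty)
qed

lemma connected_induce_arc:
  assumes "Digraph_Component.connected (with_proj H \<restriction> W)" "u \<in> W" "w \<in> W" "u \<noteq> w"
  shows "\<exists>v\<in>W. (u, v) \<in> parcs H \<or> (v, u) \<in> parcs H"
proof -
  let ?G = "with_proj H \<restriction> W"
  have "u \<rightarrow>\<^sup>*\<^bsub>with_proj (mk_symmetric ?G)\<^esub> w"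
    using assms by (auto simp: connected_def strongly_connected_def)
  then obtain v where "(u, v) \<in> arcs_ends (with_proj (mk_symmetric ?G))"
    using assms(4) unfolding reachable_def by (auto elim: converse_rtrancl_on_cases)
  then show ?thesis
    by (auto simp: parcs_mk_symmetric arcs_ends_def arc_to_ends_def)
qed

text \<open>
  A vertex with fewer than \<open>t\<close> neighbours would be isolated by deleting them, although another vertex
  remains. So every degree is at least \<open>t\<close>, and the inequality follows by summing degrees.
\<close>
lemma vertex_connected_num_edges:
  assumes H: "pair_graph H" and conn: "vertex_connected t H"
  shows "t * num_vertices H \<le> 2 * num_edges H"
proof -
  interpret pair_graph H by fact
  let ?E = "{{u, v} | u v. (u, v) \<in> parcs H}"
  have sym: "(v, u) \<in> parcs H" if "(u, v) \<in> parcs H" for u v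
    using that pair_sym_arcs by (auto simp: symmetric_def sym_def)
  have finN: "finite {v. (u, v) \<in> parcs H}" for u
    using pair_finite_verts in_arcsD2 by (auto intro: finite_subset[of _ "pverts H"])
  have degree: "t \<le> card {v. (u, v) \<in> parcs H}" if u: "u \<in> pverts H" for u
  proof (rule ccontr)
    let ?N = "{v. (u, v) \<in> parcs H}"
    assume few: "\<not> t \<le> card ?N"
    have N: "?N \<subseteq> pverts H - {u}"
      using in_arcsD2 pair_no_loops by fastforce
    have fin: "finite ?N" by (rule finN)
    have "card (pverts H) > card (insert u ?N)"
      using few conn fin by (auto simp: vertex_connected_def num_vertices_def card_insert_if)
    then have "\<not> pverts H \<subseteq> insert u ?N"
      using fin by (meson card_mono finite_insert leD)
    then obtain w where w: "w \<in> pverts H" "w \<notin> insert u ?N"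
      by blast
    have "Digraph_Component.connected (with_proj H \<restriction> (pverts H - ?N))"
      using conn few N unfolding vertex_connected_def by (meson Diff_subset not_le subset_trans)
    from connected_induce_arc[OF this, of u w] show False
      using u w N sym by auto
  qed
  \<comment> \<open>Handshake: each unordered pair carries at most two arcs.\<close>
  have card_arcs: "card (parcs H) \<le> 2 * card ?E"
  proof -
    have "parcs H \<subseteq> (\<Union>e\<in>?E. {a \<in> parcs H. {fst a, snd a} = e})"
      by force
    moreover have finE: "finite ?E"
    proof -
      have "?E = (\<lambda>a. {fst a, snd a}) ` parcs H" by force
      then show ?thesis using pair_finite_arcs by simp
    qed
    ultimately have "card (parcs H) \<le> card (\<Union>e\<in>?E. {a \<in> parcs H. {fst a, snd a} = e})"
      using pair_finite_arcs by (intro card_mono) auto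
    also have "\<dots> \<le> (\<Sum>e\<in>?E. card {a \<in> parcs H. {fst a, snd a} = e})"
      by (rule card_UN_le[OF finE])
    also have "\<dots> \<le> (\<Sum>e\<in>?E. 2)"
    proof (rule sum_mono)
      fix e assume "e \<in> ?E"
      then obtain u v where e: "e = {u, v}" by blast
      have "{a \<in> parcs H. {fst a, snd a} = e} \<subseteq> {(u, v), (v, u)}"
        using e by (auto simp: doubleton_eq_iff)
      then have "card {a \<in> parcs H. {fst a, snd a} = e} \<le> card {(u, v), (v, u)}"
        by (intro card_mono) auto
      also have "\<dots> \<le> 2" by (simp add: card_insert_le_m1)
      finally show "card {a \<in> parcs H. {fst a, snd a} = e} \<le> 2" .
    qed
    finally show ?thesis by simp
  qed
  have "parcs H = (SIGMA u:pverts H. {v. (u, v) \<in> parcs H})"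
    using in_arcsD1 by auto
  then have "card (parcs H) = (\<Sum>u\<in>pverts H. card {v. (u, v) \<in> parcs H})"
    using finN pair_finite_verts card_SigmaI[of "pverts H" "\<lambda>u. {v. (u, v) \<in> parcs H}"] by simp
  also have "\<dots> \<ge> (\<Sum>u\<in>pverts H. t)"
    by (intro sum_mono degree)
  finally have "card (parcs H) \<ge> t * num_vertices H"
    by (simp add: num_vertices_def mult.commute)
  with card_arcs show ?thesis by (simp add: num_edges_def)
qed

lemma simple_subgraph_graph_on:
  assumes "simple_subgraph H (graph_on V F)" "F \<subseteq> edge_pairs V"
  shows "pverts H \<subseteq> V" "{{u, v} | u v. (u, v) \<in> parcs H} \<subseteq> F \<inter> edge_pairs (pverts H)"
proof -
  interpret pair_graph H using assms(1) by (simp add: simple_subgraph_def)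
  show "pverts H \<subseteq> V"
    using assms by (auto simp: simple_subgraph_def subgraph_def)
  show "{{u, v} | u v. (u, v) \<in> parcs H} \<subseteq> F \<inter> edge_pairs (pverts H)"
    using assms in_arcsD1 in_arcsD2 pair_no_loops
    by (fastforce simp: simple_subgraph_def subgraph_def)
qed

section \<open>Independent coin flips\<close>

abbreviation coin_flips :: "'e set \<Rightarrow> real \<Rightarrow> ('e \<Rightarrow> bool) pmf" where
  "coin_flips E p \<equiv> Pi_pmf E False (\<lambda>_. bernoulli_pmf p)"

text \<open>
  Discrete distributions have countable support, so cutting the sides of the rectangle down to the supports
  leaves a countable sum of products of point masses.
\<close>
lemma prob_pair_pmf_rectangle:
  "measure_pmf.prob (pair_pmf M N) ({x. Q x} \<times> {y. R y}) =
     measure_pmf.prob M {x. Q x} * measure_pmf.prob N {y. R y}"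
proof -
  let ?Q = "{x. Q x} \<inter> set_pmf M" and ?R = "{y. R y} \<inter> set_pmf N"
  have "measure_pmf.prob (pair_pmf M N) ({x. Q x} \<times> {y. R y}) =
        measure_pmf.prob (pair_pmf M N) (({x. Q x} \<times> {y. R y}) \<inter> set_pmf (pair_pmf M N))"
    by (rule measure_Int_set_pmf[symmetric])
  also have "({x. Q x} \<times> {y. R y}) \<inter> set_pmf (pair_pmf M N) = ?Q \<times> ?R"
    by auto
  also have "measure_pmf.prob (pair_pmf M N) (?Q \<times> ?R) = measure_pmf.prob M ?Q * measure_pmf.prob N ?R"
    by (rule measure_pmf_prob_product) (auto intro: countable_Int2)
  finally show ?thesis by (simp add: measure_Int_set_pmf)
qed

text \<open>
  Events that look at disjoint sets of coordinates are independent, since the product distribution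
  is the merge of an independent pair of partial products.
\<close>
lemma prob_Pi_pmf_indep:
  assumes "finite E" "D \<subseteq> E"
    and Q: "\<And>f g. (\<And>x. x \<in> D \<Longrightarrow> f x = g x) \<Longrightarrow> Q f = Q g"
    and R: "\<And>f g. (\<And>x. x \<in> E - D \<Longrightarrow> f x = g x) \<Longrightarrow> R f = R g"
  shows "measure_pmf.prob (Pi_pmf E dflt P) {f. Q f \<and> R f} =
         measure_pmf.prob (Pi_pmf E dflt P) {f. Q f} * measure_pmf.prob (Pi_pmf E dflt P) {f. R f}"
proof -
  let ?D = "Pi_pmf D dflt P" and ?C = "Pi_pmf (E - D) dflt P"
  have fin: "finite D" "finite (E - D)"
    using assms(1,2) finite_subset by auto
  have E: "Pi_pmf E dflt P = map_pmf (\<lambda>(f, g) x. if x \<in> D then f x else g x) (pair_pmf ?D ?C)"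
    using Pi_pmf_union[OF fin, of dflt P] assms(2) by (simp add: Un_absorb1)
  \<comment> \<open>The same formula with a trivial event on one side also yields the two marginal probabilities.\<close>
  have *: "measure_pmf.prob (Pi_pmf E dflt P) {f. Q' f \<and> R' f} =
         measure_pmf.prob ?D {f. Q' f} * measure_pmf.prob ?C {f. R' f}"
    if Q': "\<And>f g. (\<And>x. x \<in> D \<Longrightarrow> f x = g x) \<Longrightarrow> Q' f = Q' g"
    and R': "\<And>f g. (\<And>x. x \<in> E - D \<Longrightarrow> f x = g x) \<Longrightarrow> R' f = R' g"
    for Q' R'
  proof -
    have "Q' (\<lambda>x. if x \<in> D then f x else g x) = Q' f" for f g
      by (rule Q') simp
    moreover have "R' (\<lambda>x. if x \<in> D then f x else g x) = R' g" for f g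
      by (rule R') simp
    ultimately have "(\<lambda>(f, g) x. if x \<in> D then f x else g x) -` {f. Q' f \<and> R' f} =
        {f. Q' f} \<times> {g. R' g}"
      by auto
    then show ?thesis
      by (simp add: E prob_pair_pmf_rectangle)
  qed
  have "measure_pmf.prob (Pi_pmf E dflt P) {f. Q f} = measure_pmf.prob ?D {f. Q f}"
    using *[of Q "\<lambda>_. True", OF Q] by simp
  moreover have "measure_pmf.prob (Pi_pmf E dflt P) {f. R f} = measure_pmf.prob ?C {f. R f}"
    using *[of "\<lambda>_. True", OF _ R] by simp
  ultimately show ?thesis
    using *[OF Q R] by simp
qed

lemma prob_coin_flips_const:
  assumes "finite E" "F \<subseteq> E" "0 \<le> p" "p \<le> 1"
  shows "measure_pmf.prob (coin_flips E p) {f. \<forall>e\<in>F. f e} = p ^ card F"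
    and "measure_pmf.prob (coin_flips E p) {f. \<forall>e\<in>F. \<not> f e} = (1 - p) ^ card F"
proof -
  have *: "measure_pmf.prob (coin_flips E p) {f. \<forall>e\<in>F. f e = b} = pmf (bernoulli_pmf p) b ^ card F" for b
  proof -
    have "{f. \<forall>e\<in>F. f e = b} = Pi E (\<lambda>e. if e \<in> F then {b} else UNIV)"
      using assms(2) by (auto simp: Pi_def split: if_splits)
    then have "measure_pmf.prob (coin_flips E p) {f. \<forall>e\<in>F. f e = b} =
        (\<Prod>e\<in>E. if e \<in> F then pmf (bernoulli_pmf p) b else 1)"
      using assms(1) by (simp add: measure_Pi_pmf_Pi if_distrib measure_pmf_single cong: if_cong)
    also have "\<dots> = pmf (bernoulli_pmf p) b ^ card F"
      using assms(1,2) by (simp add: prod.If_cases Int_absorb1)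
    finally show ?thesis .
  qed
  show "measure_pmf.prob (coin_flips E p) {f. \<forall>e\<in>F. f e} = p ^ card F"
    using *[of True] assms by simp
  show "measure_pmf.prob (coin_flips E p) {f. \<forall>e\<in>F. \<not> f e} = (1 - p) ^ card F"
    using *[of False] assms by simp
qed

lemma prob_coin_flips_hit_all:
  assumes "finite E" "finite J" "\<And>d. d \<in> J \<Longrightarrow> P d \<subseteq> E" "disjoint_family_on P J" "0 \<le> p" "p \<le> 1"
  shows "measure_pmf.prob (coin_flips E p) {f. \<forall>d\<in>J. \<exists>e\<in>P d. f e} =
         (\<Prod>d\<in>J. 1 - (1 - p) ^ card (P d))"
  using assms(2,3,4)
proof (induction J rule: finite_induct)
  case empty
  then show ?case by simp
next
  case (insert d J)
  have hit: "measure_pmf.prob (coin_flips E p) {f. \<exists>e\<in>P d. f e} = 1 - (1 - p) ^ card (P d)"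
  proof -
    have "{f. \<exists>e\<in>P d. f e} = UNIV - {f. \<forall>e\<in>P d. \<not> f e}" by auto
    then have "measure_pmf.prob (coin_flips E p) {f. \<exists>e\<in>P d. f e} =
       1 - measure_pmf.prob (coin_flips E p) {f. \<forall>e\<in>P d. \<not> f e}"
      using measure_pmf.prob_compl[of "{f. \<forall>e\<in>P d. \<not> f e}" "coin_flips E p"] by simp
    then show ?thesis
      using prob_coin_flips_const(2)[OF assms(1) insert.prems(1)[of d]] assms(5,6) by simp
  qed
  have avoid: "e \<in> E - P d" if "d' \<in> J" "e \<in> P d'" for d' e
    using that insert.prems insert.hyps(2) by (fastforce simp: disjoint_family_on_def)
  have "measure_pmf.prob (coin_flips E p) {f. (\<exists>e\<in>P d. f e) \<and> (\<forall>d\<in>J. \<exists>e\<in>P d. f e)} =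
     measure_pmf.prob (coin_flips E p) {f. \<exists>e\<in>P d. f e} *
     measure_pmf.prob (coin_flips E p) {f. \<forall>d\<in>J. \<exists>e\<in>P d. f e}"
  proof (rule prob_Pi_pmf_indep[OF assms(1), of "P d"])
    show "P d \<subseteq> E" using insert.prems(1) by simp
    show "(\<exists>e\<in>P d. f e) = (\<exists>e\<in>P d. g e)" if "\<And>x. x \<in> P d \<Longrightarrow> f x = g x" for f g
      using that by simp
    show "(\<forall>d\<in>J. \<exists>e\<in>P d. f e) = (\<forall>d\<in>J. \<exists>e\<in>P d. g e)"
      if eq: "\<And>x. x \<in> E - P d \<Longrightarrow> f x = g x" for f g
      by (intro ball_cong bex_cong refl eq avoid)
  qed
  also have "\<dots> = (1 - (1 - p) ^ card (P d)) * (\<Prod>d\<in>J. 1 - (1 - p) ^ card (P d))"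
    using hit insert by (simp add: disjoint_family_on_def)
  finally show ?case using insert.hyps by simp
qed

lemma power_le_exp_mult_fact:
  "real k ^ k \<le> exp (real k) * fact k"
proof -
  have "(real k ^ k) /\<^sub>R fact k \<le> exp (real k)"
  proof -
    have "(\<Sum>i\<in>{k}. (real k ^ i) /\<^sub>R fact i) \<le> (\<Sum>i. (real k ^ i) /\<^sub>R fact i)"
      by (rule sum_le_suminf[OF summable_exp_generic]) auto
    then show ?thesis by (simp add: exp_def)
  qed
  then show ?thesis by (simp add: field_simps)
qed

text \<open>
  At least \<open>k\<close> successes in \<open>S\<close> contain \<open>k\<close> chosen ones, so the union bound gives
  \<open>(card S choose k) * p ^ k\<close>; the factor \<open>e\<close> enters through \<open>k! \<ge> (k / e) ^ k\<close>.
\<close>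
lemma prob_coin_flips_many:
  assumes "finite E" "S \<subseteq> E" "0 \<le> p" "p \<le> 1" "0 < k"
  shows "measure_pmf.prob (coin_flips E p) {f. k \<le> card {e \<in> S. f e}} \<le>
         (exp 1 * real (card S) * p / real k) ^ k"
proof -
  have finS: "finite S" using assms(1,2) finite_subset by blast
  let ?K = "{F. F \<subseteq> S \<and> card F = k}"
  have "{f. k \<le> card {e \<in> S. f e}} \<subseteq> (\<Union>F\<in>?K. {f. \<forall>e\<in>F. f e})"
  proof
    fix f assume "f \<in> {f. k \<le> card {e \<in> S. f e}}"
    then obtain F where "F \<subseteq> {e \<in> S. f e}" "card F = k"
      by (auto elim: obtain_subset_with_card_n)
    then show "f \<in> (\<Union>F\<in>?K. {f. \<forall>e\<in>F. f e})" by blast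
  qed
  then have "measure_pmf.prob (coin_flips E p) {f. k \<le> card {e \<in> S. f e}} \<le>
      measure_pmf.prob (coin_flips E p) (\<Union>F\<in>?K. {f. \<forall>e\<in>F. f e})"
    by (intro measure_pmf.finite_measure_mono) auto
  also have "\<dots> \<le> (\<Sum>F\<in>?K. measure_pmf.prob (coin_flips E p) {f. \<forall>e\<in>F. f e})"
    using finS by (intro measure_pmf.finite_measure_subadditive_finite) auto
  also have "\<dots> = (\<Sum>F\<in>?K. p ^ k)"
  proof (rule sum.cong)
    fix F assume "F \<in> ?K"
    then show "measure_pmf.prob (coin_flips E p) {f. \<forall>e\<in>F. f e} = p ^ k"
      using prob_coin_flips_const(1)[OF assms(1) _ assms(3,4), of F] assms(2) by auto
  qed simp
  also have "\<dots> = real (card S choose k) * p ^ k"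
    using finS by (simp add: n_subsets)
  also have "\<dots> \<le> (exp 1 * real (card S) / real k) ^ k * p ^ k"
  proof (rule mult_right_mono)
    have "real (card S choose k) * real k ^ k \<le> real (card S choose k) * (exp (real k) * fact k)"
      by (intro mult_left_mono power_le_exp_mult_fact) simp
    also have "\<dots> = exp (real k) * real ((card S choose k) * fact k)"
      by simp
    also have "\<dots> \<le> exp (real k) * real (card S ^ k)"
      by (intro mult_left_mono of_nat_mono binomial_fact_pow) simp
    also have "\<dots> = (exp 1 * real (card S)) ^ k"
      by (simp add: power_mult_distrib exp_of_nat_mult[symmetric])
    finally show "real (card S choose k) \<le> (exp 1 * real (card S) / real k) ^ k"
      using assms(5) by (simp add: power_divide field_simps)
  qed (use assms(3) in simp)
  also have "\<dots> = (exp 1 * real (card S) * p / real k) ^ k"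
    by (simp add: power_mult_distrib power_divide)
  finally show ?thesis .
qed

text \<open>
  The mean number of successes is \<open>p * card E\<close>. The outcomes in \<open>Bad\<close> contribute at most
  \<open>card E\<close> times their probability, less than half of this mean, so some outcome outside \<open>Bad\<close> reaches the other
  half. This replaces a lower tail estimate for the number of edges.
\<close>
lemma coin_flips_exists_good:
  assumes "finite E" "0 \<le> p" "p \<le> 1" "E \<noteq> {}"
    and bad: "measure_pmf.prob (coin_flips E p) Bad < p / 2"
  obtains f where "f \<notin> Bad" "real (card {e \<in> E. f e}) \<ge> p * real (card E) / 2"
proof -
  let ?X = "\<lambda>f. real (card {e \<in> E. f e})"
  have fin: "finite (set_pmf (coin_flips E p))"
    using assms(1) by (intro finite_subset[OF set_Pi_pmf_subset'] finite_PiE_dflt) auto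
  have X: "?X f = (\<Sum>e\<in>E. indicator {f. f e} f)" for f
  proof -
    have "(\<Sum>e\<in>E. indicator {f. f e} f :: real) = (\<Sum>e\<in>E. if f e then 1 else 0)"
      by (intro sum.cong) auto
    also have "\<dots> = ?X f"
      using assms(1) by (simp add: sum.inter_filter[symmetric])
    finally show ?thesis ..
  qed
  have "p * real (card E) = (\<Sum>e\<in>E. measure_pmf.prob (coin_flips E p) {f. f e})"
    using prob_coin_flips_const(1)[OF assms(1) _ assms(2,3), of "{_}"] by simp
  also have "\<dots> = measure_pmf.expectation (coin_flips E p) ?X"
    unfolding X by (subst Bochner_Integration.integral_sum) (auto intro: integrable_measure_pmf_finite fin)
  finally have mean: "measure_pmf.expectation (coin_flips E p) ?X = p * real (card E)" ..
  show ?thesis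
  proof (rule ccontr)
    assume none: "\<not> thesis"
    have le: "?X f \<le> p * real (card E) / 2 + real (card E) * indicator Bad f" for f
    proof (cases "f \<in> Bad")
      case True
      have "?X f \<le> real (card E)" using assms(1) by (simp add: card_mono)
      moreover have "0 \<le> p * real (card E) / 2" using assms(2) by simp
      ultimately show ?thesis using True by simp
    next
      case False
      then show ?thesis using that[of f] none by force
    qed
    have "p * real (card E) = measure_pmf.expectation (coin_flips E p) ?X"
      by (rule mean[symmetric])
    also have "\<dots> \<le> measure_pmf.expectation (coin_flips E p)
        (\<lambda>f. p * real (card E) / 2 + real (card E) * indicator Bad f)"
      by (intro integral_mono integrable_measure_pmf_finite fin le)
    also have "\<dots> = p * real (card E) / 2 + real (card E) * measure_pmf.prob (coin_flips E p) Bad"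
      by (subst Bochner_Integration.integral_add) (simp_all add: integrable_measure_pmf_finite fin)
    also have "\<dots> < p * real (card E) / 2 + real (card E) * (p / 2)"
      using assms(1,4) by (intro add_strict_left_mono mult_strict_left_mono bad) (simp add: card_gt_0_iff)
    finally show False by (simp add: field_simps)
  qed
qed

section \<open>Minors and dense subsets of a random graph\<close>

lemma card_edges_between_le:
  assumes "finite V"
  shows "card {e \<in> edge_pairs V. \<phi> ` e = {i, j}} \<le> card {v \<in> V. \<phi> v = i} * card {v \<in> V. \<phi> v = j}"
proof -
  let ?B = "\<lambda>i. {v \<in> V. \<phi> v = i}"
  have "{e \<in> edge_pairs V. \<phi> ` e = {i, j}} \<subseteq> (\<lambda>(u, v). {u, v}) ` (?B i \<times> ?B j)"
  proof
    fix e assume e: "e \<in> {e \<in> edge_pairs V. \<phi> ` e = {i, j}}"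
    then obtain u v where uv: "e = {u, v}" "u \<in> V" "v \<in> V"
      by (auto elim: edge_pairsE)
    with e have "{\<phi> u, \<phi> v} = {i, j}" by simp
    then consider "\<phi> u = i" "\<phi> v = j" | "\<phi> u = j" "\<phi> v = i"
      by (auto simp: doubleton_eq_iff)
    then show "e \<in> (\<lambda>(u, v). {u, v}) ` (?B i \<times> ?B j)"
    proof cases
      case 1
      then show ?thesis using uv by (intro image_eqI[of _ _ "(u, v)"]) auto
    next
      case 2
      then show ?thesis using uv by (intro image_eqI[of _ _ "(v, u)"]) auto
    qed
  qed
  then have "card {e \<in> edge_pairs V. \<phi> ` e = {i, j}} \<le> card ((\<lambda>(u, v). {u, v}) ` (?B i \<times> ?B j))"
    using assms by (intro card_mono) auto
  also have "\<dots> \<le> card (?B i \<times> ?B j)"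
    using assms by (intro card_image_le) auto
  finally show ?thesis by (simp add: card_cartesian_product)
qed

text \<open>
  As many as \<open>t / 2\<close> bags of more than twice the average size \<open>card V / t\<close> would contain more
  than \<open>card V\<close> vertices in total. Vertices with labels \<open>\<phi> v \<ge> t\<close> lie in no bag.
\<close>
lemma half_of_bags_small:
  fixes \<phi> :: "'a \<Rightarrow> nat"
  assumes "finite V" "0 < t"
  shows "t \<le> 2 * card {i \<in> {..<t}. card {v \<in> V. \<phi> v = i} \<le> 2 * card V div t}"
proof -
  let ?l = "2 * card V div t" and ?B = "\<lambda>i. {v \<in> V. \<phi> v = i}"
  let ?S = "{i \<in> {..<t}. card (?B i) \<le> ?l}" and ?L = "{i \<in> {..<t}. \<not> card (?B i) \<le> ?l}"
  have "?S \<union> ?L = {..<t}" by auto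
  then have split: "card ?S + card ?L = t"
    by (subst card_Un_disjoint[symmetric]) auto
  have "card ?L * (?l + 1) = (\<Sum>i\<in>?L. ?l + 1)" by simp
  also have "\<dots> \<le> (\<Sum>i\<in>?L. card (?B i))"
    by (rule sum_mono) auto
  also have "\<dots> = card (\<Union>i\<in>?L. ?B i)"
    using assms(1) by (intro card_UN_disjoint[symmetric]) auto
  also have "\<dots> \<le> card V"
    using assms(1) by (intro card_mono) auto
  finally have large: "card ?L * (?l + 1) \<le> card V" .
  have "2 * card V < t * (?l + 1)"
    using assms(2) by (metis Suc_eq_plus1 dividend_less_times_div mult_Suc_right add.commute)
  with large have "(2 * card ?L) * (?l + 1) < t * (?l + 1)"
    by (metis (no_types, lifting) le_less_trans mult.assoc mult_le_mono2)
  then have "2 * card ?L < t" by (rule mult_less_cancel2[THEN iffD1, THEN conjunct2])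
  with split show ?thesis by linarith
qed

lemma real_choose_two: "real (n choose 2) = real n * (real n - 1) / 2"
proof (cases n)
  case (Suc m)
  have "2 dvd Suc m * m" by simp
  then show ?thesis
    unfolding choose_two using Suc real_of_nat_div[of 2 "Suc m * m"] by (simp add: algebra_simps)
qed simp

lemma exp_minus_double_le:
  fixes p :: real
  assumes "0 \<le> p" "p \<le> 1 / 2"
  shows "exp (- 2 * p) \<le> 1 - p"
proof -
  have "- p - 2 * p\<^sup>2 \<le> ln (1 - p)"
    using assms by (rule ln_one_minus_pos_lower_bound)
  moreover have "2 * p\<^sup>2 \<le> p"
    using assms mult_left_mono[of p "1/2" p] by (simp add: power2_eq_square)
  ultimately have "- 2 * p \<le> ln (1 - p)" by linarith
  then have "exp (- 2 * p) \<le> exp (ln (1 - p))" by (simp only: exp_le_cancel_iff)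
  then show ?thesis using assms by simp
qed

text \<open>
  Among the at least \<open>t / 2\<close> bags of size at most \<open>2 n / t\<close>, where \<open>n = card V\<close>, each pair spans at
  most \<open>4 n\<^sup>2 / t\<^sup>2\<close> vertex pairs, so it misses all edges with probability at least
  \<open>(1 - p) ^ (4 n\<^sup>2 / t\<^sup>2) \<ge> exp (- 8 p n\<^sup>2 / t\<^sup>2)\<close>. Different pairs of bags depend on different edges, so the
  bounds multiply over at least \<open>(t / 2) (t / 2 - 1) / 2\<close> pairs. As edges are two-element sets, the
  edges between bags \<open>i\<close> and \<open>j\<close> are those with \<open>\<phi> ` e = {i, j}\<close>, which makes disjointness immediate.
\<close>
lemma prob_bags_pairwise_joined:
  fixes \<phi> :: "'a \<Rightarrow> nat"
  assumes "finite V" "2 \<le> t" "0 \<le> p" "p \<le> 1 / 2"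
  shows "measure_pmf.prob (coin_flips (edge_pairs V) p)
           {f. \<forall>d\<in>edge_pairs {..<t}. \<exists>e\<in>edge_pairs V. f e \<and> \<phi> ` e = d} \<le>
         exp (- (exp (- (8 * p * (real (card V))\<^sup>2 / (real t)\<^sup>2)) *
           (real t / 2 * (real t / 2 - 1) / 2)))"
proof -
  let ?l = "2 * card V div t" and ?P = "\<lambda>d. {e \<in> edge_pairs V. \<phi> ` e = d}"
  let ?q = "exp (- (8 * p * (real (card V))\<^sup>2 / (real t)\<^sup>2))"
  define S where "S = {i \<in> {..<t}. card {v \<in> V. \<phi> v = i} \<le> ?l}"
  have [simp]: "finite S" by (simp add: S_def)
  have S: "t \<le> 2 * card S" unfolding S_def using assms by (intro half_of_bags_small) auto
  have no_edge: "?q \<le> (1 - p) ^ card (?P d)" if "d \<in> edge_pairs S" for d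
  proof -
    obtain i j where ij: "d = {i, j}" "i \<in> S" "j \<in> S"
      using edge_pairsE[OF \<open>d \<in> edge_pairs S\<close>] by metis
    have "card (?P d) \<le> card {v \<in> V. \<phi> v = i} * card {v \<in> V. \<phi> v = j}"
      unfolding ij(1) by (rule card_edges_between_le[OF assms(1)])
    also have "\<dots> \<le> ?l * ?l"
      using ij by (intro mult_le_mono) (auto simp: S_def)
    finally have card_le: "real (card (?P d)) \<le> real ?l * real ?l"
      by (metis of_nat_le_iff of_nat_mult)
    have l: "real ?l \<le> 2 * real (card V) / real t"
      by (metis of_nat_div_le_of_nat of_nat_mult of_nat_numeral)
    have "real ?l * real ?l \<le> (2 * real (card V) / real t) * (2 * real (card V) / real t)"
      using l by (intro mult_mono) auto
    then have "real (card (?P d)) \<le> 4 * (real (card V))\<^sup>2 / (real t)\<^sup>2"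
      using card_le by (simp add: power2_eq_square)
    then have "2 * p * real (card (?P d)) \<le> 2 * p * (4 * (real (card V))\<^sup>2 / (real t)\<^sup>2)"
      using assms(3) by (intro mult_left_mono) auto
    then have "?q \<le> exp (real (card (?P d)) * (- 2 * p))"
      by (simp add: mult_ac)
    also have "\<dots> = exp (- 2 * p) ^ card (?P d)"
      by (rule exp_of_nat_mult)
    also have "\<dots> \<le> (1 - p) ^ card (?P d)"
      using assms by (intro power_mono exp_minus_double_le) auto
    finally show ?thesis .
  qed
  have "{f. \<forall>d\<in>edge_pairs {..<t}. \<exists>e\<in>edge_pairs V. f e \<and> \<phi> ` e = d}
      \<subseteq> {f. \<forall>d\<in>edge_pairs S. \<exists>e\<in>?P d. f e}"
  proof -
    have "edge_pairs S \<subseteq> edge_pairs {..<t}"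
      by (rule edge_pairs_mono) (auto simp: S_def)
    then show ?thesis by blast
  qed
  then have "measure_pmf.prob (coin_flips (edge_pairs V) p)
           {f. \<forall>d\<in>edge_pairs {..<t}. \<exists>e\<in>edge_pairs V. f e \<and> \<phi> ` e = d} \<le>
      measure_pmf.prob (coin_flips (edge_pairs V) p) {f. \<forall>d\<in>edge_pairs S. \<exists>e\<in>?P d. f e}"
    by (intro measure_pmf.finite_measure_mono) auto
  also have "\<dots> = (\<Prod>d\<in>edge_pairs S. 1 - (1 - p) ^ card (?P d))"
    using assms by (intro prob_coin_flips_hit_all) (auto simp: disjoint_family_on_def)
  also have "\<dots> \<le> (\<Prod>d\<in>edge_pairs S. exp (- ?q))"
  proof (rule prod_mono, rule conjI)
    fix d assume d: "d \<in> edge_pairs S"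
    show "0 \<le> 1 - (1 - p) ^ card (?P d)"
      using assms by (simp add: power_le_one)
    have "1 - (1 - p) ^ card (?P d) \<le> 1 + (- ?q)" using no_edge[OF d] by simp
    also have "\<dots> \<le> exp (- ?q)" by (rule exp_ge_add_one_self)
    finally show "1 - (1 - p) ^ card (?P d) \<le> exp (- ?q)" .
  qed
  also have "\<dots> = exp (- (?q * real (card S choose 2)))"
    by (simp add: card_edge_pairs exp_of_nat_mult[symmetric] mult.commute)
  also have "\<dots> \<le> exp (- (?q * (real t / 2 * (real t / 2 - 1) / 2)))"
  proof -
    have "real t / 2 * (real t / 2 - 1) \<le> real (card S) * (real (card S) - 1)"
      using S assms(2) by (intro mult_mono) auto
    also have "\<dots> = 2 * real (card S choose 2)"
      by (simp add: real_choose_two)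
    finally show ?thesis by simp
  qed
  finally show ?thesis .
qed

text \<open>
  Write \<open>m = card X\<close> and let \<open>k\<close> be \<open>t m / 2\<close> rounded up. Since \<open>X\<close> spans at most \<open>m\<^sup>2 / 2\<close> pairs, the base
  in the upper tail bound for \<open>k\<close> edges is at most \<open>e m p / t \<le> 1 / 2\<close>, and \<open>k \<ge> t\<^sup>2 / 2\<close> because \<open>m > t\<close>.
\<close>
lemma prob_dense_vertex_subset:
  assumes "finite V" "X \<subseteq> V" "0 \<le> p" "p \<le> 1" "t < card X"
    and sparse: "2 * exp 1 * real (card X) * p \<le> real t"
  shows "measure_pmf.prob (coin_flips (edge_pairs V) p)
           {f. t * card X \<le> 2 * card {e \<in> edge_pairs X. f e}} \<le> 2 powr (- ((real t)\<^sup>2 / 2))"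
proof (cases "t = 0")
  case True
  then show ?thesis by simp
next
  case False
  let ?m = "card X"
  define k where "k = (t * ?m + 1) div 2"
  have finX: "finite X" using assms(1,2) finite_subset by blast
  have k: "real t * real ?m / 2 \<le> real k"
  proof -
    have "t * ?m \<le> 2 * k" by (simp add: k_def)
    then have "real (t * ?m) \<le> real (2 * k)" by (simp only: of_nat_le_iff)
    then show ?thesis by simp
  qed
  have tm: "0 < real t * real ?m" using False assms(5) by simp
  then have k0: "0 < k" using k by (cases k) auto
  have "{f. t * ?m \<le> 2 * card {e \<in> edge_pairs X. f e}} = {f. k \<le> card {e \<in> edge_pairs X. f e}}"
    by (auto simp: k_def)
  then have "measure_pmf.prob (coin_flips (edge_pairs V) p)
           {f. t * ?m \<le> 2 * card {e \<in> edge_pairs X. f e}} \<le>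
         (exp 1 * real (card (edge_pairs X)) * p / real k) ^ k"
    using prob_coin_flips_many[of "edge_pairs V" "edge_pairs X" p k] assms k0
    by (simp add: edge_pairs_mono)
  also have "\<dots> \<le> (1 / 2) ^ k"
  proof (rule power_mono)
    have "2 * (?m choose 2) \<le> ?m * ?m"
      unfolding choose_two by (rule order_trans[OF times_div_less_eq_dividend]) simp
    then have "2 * real (card (edge_pairs X)) \<le> real ?m * real ?m"
      using finX by (metis card_edge_pairs of_nat_le_iff of_nat_mult of_nat_numeral)
    then have "(2 * real (card (edge_pairs X))) * (exp 1 * p) \<le> (real ?m * real ?m) * (exp 1 * p)"
      using assms(3) by (intro mult_right_mono) auto
    also have "\<dots> = real ?m * (2 * exp 1 * real ?m * p) / 2" by simp
    also have "\<dots> \<le> real ?m * real t / 2"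
      using sparse by (intro divide_right_mono mult_left_mono) auto
    also have "\<dots> \<le> real k" using k by (simp add: mult.commute)
    finally show "exp 1 * real (card (edge_pairs X)) * p / real k \<le> 1 / 2"
      using k0 by (simp add: field_simps)
    show "0 \<le> exp 1 * real (card (edge_pairs X)) * p / real k"
      using assms(3) by simp
  qed
  also have "\<dots> = 2 powr (- real k)"
    by (simp add: powr_minus powr_realpow power_one_over inverse_eq_divide)
  also have "\<dots> \<le> 2 powr (- ((real t)\<^sup>2 / 2))"
  proof -
    have "real t * real t \<le> real t * real ?m" using assms(5) by (intro mult_left_mono) auto
    with k have "(real t)\<^sup>2 / 2 \<le> real k" by (simp add: power2_eq_square)
    then show ?thesis by (intro powr_mono) auto
  qed
  finally show ?thesis .
qed

text \<open>
  The union bound runs over the \<open>(t + 1) ^ n\<close> labellings of the vertices and, for dense subsets, crudely over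
  all \<open>2 ^ n\<close> vertex sets.
\<close>
lemma exists_good_edge_set:
  fixes V :: "'a set" and p \<sigma> :: real
  assumes "finite V" "2 \<le> t" "2 \<le> card V" "0 < p" "p \<le> 1 / 2"
    and sparse: "2 * exp 1 * \<sigma> * p \<le> real t"
    and total: "real (t + 1) ^ card V * exp (- (exp (- (8 * p * (real (card V))\<^sup>2 / (real t)\<^sup>2)) *
        (real t / 2 * (real t / 2 - 1) / 2)))
      + 2 ^ card V * 2 powr (- ((real t)\<^sup>2 / 2)) < p / 2"
  obtains F where "F \<subseteq> edge_pairs V"
    and "p * real (card V choose 2) / 2 \<le> real (card F)"
    and "\<And>\<phi>. \<phi> \<in> V \<rightarrow>\<^sub>E {..t} \<Longrightarrow> \<exists>d\<in>edge_pairs {..<t}. \<forall>e\<in>F. \<phi> ` e \<noteq> d"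
    and "\<And>X. X \<subseteq> V \<Longrightarrow> t < card X \<Longrightarrow> real (card X) \<le> \<sigma> \<Longrightarrow> 2 * card (F \<inter> edge_pairs X) < t * card X"
proof -
  let ?n = "card V" and ?prob = "measure_pmf.prob (coin_flips (edge_pairs V) p)"
  define \<Phi> where "\<Phi> = (V \<rightarrow>\<^sub>E {..t})"
  define \<X> where "\<X> = {X. X \<subseteq> V \<and> t < card X \<and> real (card X) \<le> \<sigma>}"
  define M where "M = (\<lambda>\<phi>. {f. \<forall>d\<in>edge_pairs {..<t}. \<exists>e\<in>edge_pairs V. f e \<and> \<phi> ` e = d})"
  define D where "D = (\<lambda>X :: 'a set. {f. t * card X \<le> 2 * card {e \<in> edge_pairs X. f e}})"
  let ?\<mu> = "exp (- (exp (- (8 * p * (real ?n)\<^sup>2 / (real t)\<^sup>2)) * (real t / 2 * (real t / 2 - 1) / 2)))"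
  let ?\<delta> = "2 powr (- ((real t)\<^sup>2 / 2)) :: real"
  have fin: "finite \<Phi>" "finite \<X>"
    using assms(1) by (auto simp: \<Phi>_def \<X>_def intro: finite_PiE)
  have "?prob (\<Union>\<phi>\<in>\<Phi>. M \<phi>) \<le> (\<Sum>\<phi>\<in>\<Phi>. ?prob (M \<phi>))"
    using fin by (intro measure_pmf.finite_measure_subadditive_finite) auto
  also have "\<dots> \<le> (\<Sum>\<phi>\<in>\<Phi>. ?\<mu>)"
    unfolding M_def using assms by (intro sum_mono prob_bags_pairwise_joined) auto
  also have "\<dots> = real (t + 1) ^ ?n * ?\<mu>"
    using assms(1) by (simp add: \<Phi>_def card_PiE add.commute)
  finally have minors: "?prob (\<Union>\<phi>\<in>\<Phi>. M \<phi>) \<le> real (t + 1) ^ ?n * ?\<mu>" .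
  have D: "?prob (D X) \<le> ?\<delta>" if "X \<in> \<X>" for X
  proof -
    have X: "X \<subseteq> V" "t < card X" "real (card X) \<le> \<sigma>"
      using that by (auto simp: \<X>_def)
    have "2 * exp 1 * real (card X) * p \<le> 2 * exp 1 * \<sigma> * p"
      using X(3) assms(4) by (intro mult_right_mono mult_left_mono) auto
    then have "2 * exp 1 * real (card X) * p \<le> real t"
      using sparse by linarith
    then show ?thesis
      unfolding D_def using X assms by (intro prob_dense_vertex_subset) auto
  qed
  have "?prob (\<Union>X\<in>\<X>. D X) \<le> (\<Sum>X\<in>\<X>. ?prob (D X))"
    using fin by (intro measure_pmf.finite_measure_subadditive_finite) auto
  also have "\<dots> \<le> (\<Sum>X\<in>\<X>. ?\<delta>)"
    by (intro sum_mono D)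
  also have "\<dots> = real (card \<X>) * ?\<delta>" by simp
  also have "\<dots> \<le> 2 ^ ?n * ?\<delta>"
  proof (rule mult_right_mono)
    have "card \<X> \<le> card (Pow V)"
      using assms(1) by (intro card_mono) (auto simp: \<X>_def)
    then have "card \<X> \<le> 2 ^ ?n" using assms(1) by (simp add: card_Pow)
    then have "real (card \<X>) \<le> real (2 ^ ?n)" by (simp only: of_nat_le_iff)
    then show "real (card \<X>) \<le> 2 ^ ?n" by simp
  qed simp
  finally have dense: "?prob (\<Union>X\<in>\<X>. D X) \<le> 2 ^ ?n * ?\<delta>" .
  have "?prob ((\<Union>\<phi>\<in>\<Phi>. M \<phi>) \<union> (\<Union>X\<in>\<X>. D X)) \<le> ?prob (\<Union>\<phi>\<in>\<Phi>. M \<phi>) + ?prob (\<Union>X\<in>\<X>. D X)"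
    by (intro measure_Un_le) auto
  then have bad: "?prob ((\<Union>\<phi>\<in>\<Phi>. M \<phi>) \<union> (\<Union>X\<in>\<X>. D X)) < p / 2"
    using minors dense total by linarith
  have nonempty: "edge_pairs V \<noteq> {}"
  proof -
    have "0 < ?n choose 2" using assms(3) by (simp add: zero_less_binomial_iff)
    then show ?thesis using assms(1) by (metis card.empty card_edge_pairs less_irrefl)
  qed
  obtain f where f: "f \<notin> (\<Union>\<phi>\<in>\<Phi>. M \<phi>) \<union> (\<Union>X\<in>\<X>. D X)"
    and many: "p * real (card (edge_pairs V)) / 2 \<le> real (card {e \<in> edge_pairs V. f e})"
    using coin_flips_exists_good[OF _ _ _ nonempty bad] assms by auto
  define F where "F = {e \<in> edge_pairs V. f e}"
  show ?thesis
  proof (rule that[of F])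
    show "F \<subseteq> edge_pairs V" by (auto simp: F_def)
    show "p * real (?n choose 2) / 2 \<le> real (card F)"
      using many assms(1) by (simp add: F_def card_edge_pairs)
    show "\<exists>d\<in>edge_pairs {..<t}. \<forall>e\<in>F. \<phi> ` e \<noteq> d" if "\<phi> \<in> V \<rightarrow>\<^sub>E {..t}" for \<phi>
    proof -
      have "f \<notin> M \<phi>" using f that by (auto simp: \<Phi>_def)
      then show ?thesis by (auto simp: M_def F_def)
    qed
    show "2 * card (F \<inter> edge_pairs X) < t * card X"
      if "X \<subseteq> V" "t < card X" "real (card X) \<le> \<sigma>" for X
    proof -
      have "f \<notin> D X" using f that by (auto simp: \<X>_def)
      moreover have "F \<inter> edge_pairs X = {e \<in> edge_pairs X. f e}"
        using edge_pairs_mono[OF that(1)] by (auto simp: F_def)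
      ultimately show ?thesis by (simp add: D_def)
    qed
  qed
qed

section \<open>Choice of the parameters\<close>

text \<open>
  The choice is \<open>n = \<lceil>t ln t / (450 A)\<rceil>\<close> and \<open>p = 8 A t / n\<close>. The numerator \<open>8 A t\<close> makes half the expected number of
  edges, \<open>p n (n - 1) / 4 = 2 A t (n - 1)\<close>, at least \<open>A t n\<close>. The lower bound \<open>t ln t / (450 A)\<close> on \<open>n\<close> makes
  subsets of \<open>t ln t / (7200 e A\<^sup>2)\<close> vertices sparse enough; this determines the constant
  \<open>7200 = 2 * 8 * 450\<close>. For the minors, any upper bound \<open>n \<le> t ln t / (128 A)\<close> suffices: then
  \<open>8 p n\<^sup>2 / t\<^sup>2 = 64 A n / t \<le> ln t / 2\<close>, so the exponent of order \<open>t\<^sup>2 / \<surd>t\<close> beats the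
  \<open>n ln (t + 1)\<close> from the number of labellings. The second summand is small because \<open>n\<close> is of lower order than \<open>t\<^sup>2\<close>,
  while \<open>p\<close> only decays like \<open>1 / ln t\<close>.
\<close>
lemma parameters_eventually:
  fixes A :: nat
  assumes "A \<ge> 2"
  shows "\<forall>\<^sub>F t in sequentially. \<exists>n p. 2 \<le> t \<and> 2 \<le> n \<and> 0 < p \<and> p \<le> 1 / 2 \<and>
    p * real n = 8 * real A * real t \<and>
    2 * exp 1 * (1 / (7200 * exp 1 * (real A)\<^sup>2) * (real t * ln (real t))) * p \<le> real t \<and>
    real (t + 1) ^ n * exp (- (exp (- (8 * p * (real n)\<^sup>2 / (real t)\<^sup>2)) *
        (real t / 2 * (real t / 2 - 1) / 2)))
      + 2 ^ n * 2 powr (- ((real t)\<^sup>2 / 2)) < p / 2"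
proof -
  let ?a = "real A"
  have a: "?a \<ge> 2" using assms by simp
  \<comment> \<open>This one gives \<open>p \<le> 1 / 2\<close>, the next absorbs the rounding of \<open>n\<close>, and the third compares the failure probability with \<open>1 / ln t < p / 2\<close>.\<close>
  have ev1: "\<forall>\<^sub>F t::nat in sequentially. 7200 * ?a\<^sup>2 \<le> ln (real t)" by real_asymp
  have ev2: "\<forall>\<^sub>F t::nat in sequentially. real t * ln (real t) / (450 * ?a) + 1 \<le> real t * ln (real t) / (128 * ?a)"
    using a by real_asymp
  have ev3: "\<forall>\<^sub>F t::nat in sequentially.
     exp (real t * ln (real t) * ln (real t + 1) - real t powr (- (1/2)) * (real t / 2 * (real t / 2 - 1) / 2))
     + 2 powr (real t * ln (real t) - (real t)\<^sup>2 / 2) < 1 / ln (real t)"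
    by real_asymp
  have ev4: "\<forall>\<^sub>F t::nat in sequentially. 2 \<le> t" by (rule eventually_ge_at_top)
  show ?thesis
    using ev1 ev2 ev3 ev4
  proof eventually_elim
    case (elim t)
    let ?t = "real t" and ?L = "ln (real t)"
    define n where "n = nat \<lceil>?t * ?L / (450 * ?a)\<rceil>"
    define p where "p = 8 * ?a * ?t / real n"
    have t: "?t \<ge> 2" using elim by simp
    have L: "?L > 0" using t by simp
    have pos: "?t * ?L / (450 * ?a) > 0" using t L a by simp
    have n_lower: "?t * ?L / (450 * ?a) \<le> real n"
      unfolding n_def by (rule real_nat_ceiling_ge)
    have n_upper: "real n \<le> ?t * ?L / (128 * ?a)"
      using elim(2) pos of_nat_ceiling[of "?t * ?L / (450 * ?a)"] unfolding n_def by linarith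
    have n16: "16 * ?a * ?t \<le> real n"
    proof -
      have "16 * ?a * ?t = ?t * (7200 * ?a\<^sup>2) / (450 * ?a)"
        using a by (simp add: power2_eq_square)
      also have "\<dots> \<le> ?t * ?L / (450 * ?a)"
        using elim(1) a t by (intro divide_right_mono mult_left_mono) auto
      finally show ?thesis using n_lower by simp
    qed
    have at: "?a * ?t \<ge> 2 * 2" using a t by (intro mult_mono) auto
    have n0: "real n > 0" and n2: "2 \<le> n" using n16 at by linarith+
    have p0: "p > 0" unfolding p_def using n0 a t by simp
    have p_half: "p \<le> 1 / 2" unfolding p_def using n0 n16 by (simp add: field_simps)
    have pn: "p * real n = 8 * ?a * ?t" unfolding p_def using n0 by simp
    have p_upper: "p \<le> 3600 * ?a\<^sup>2 / ?L"
    proof -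
      have "p \<le> 8 * ?a * ?t / (?t * ?L / (450 * ?a))"
        unfolding p_def using n_lower pos a t n0 by (intro divide_left_mono mult_pos_pos) auto
      also have "\<dots> = 3600 * ?a\<^sup>2 / ?L"
        using a t L by (simp add: field_simps power2_eq_square)
      finally show ?thesis .
    qed
    have sparse: "2 * exp 1 * (1 / (7200 * exp 1 * ?a\<^sup>2) * (?t * ?L)) * p \<le> ?t"
    proof -
      have "2 * exp 1 * (1 / (7200 * exp 1 * ?a\<^sup>2) * (?t * ?L)) * p = ?t * ?L / (3600 * ?a\<^sup>2) * p"
        by (simp add: field_simps)
      also have "\<dots> \<le> ?t * ?L / (3600 * ?a\<^sup>2) * (3600 * ?a\<^sup>2 / ?L)"
        using p_upper t L by (intro mult_left_mono) auto
      also have "\<dots> = ?t" using L a by (simp add: field_simps)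
      finally show ?thesis .
    qed
    have p_lower: "1 / ?L < p / 2"
    proof -
      have "p * (?t * ?L / (128 * ?a)) \<ge> p * real n"
        using p0 n_upper by (intro mult_left_mono) auto
      then have "p * (?t * ?L) \<ge> 8 * ?a * ?t * (128 * ?a)"
        using a unfolding pn by (simp add: field_simps)
      then have "p * ?L * ?t \<ge> 1024 * (?a * ?a) * ?t" by (simp add: mult_ac)
      then have "p * ?L \<ge> 1024 * (?a * ?a)" using t by simp
      moreover have "?a * ?a \<ge> 2 * 2" using a by (intro mult_mono) auto
      ultimately have "p * ?L > 2" by linarith
      then show ?thesis using L by (simp add: field_simps)
    qed
    have n_le: "real n \<le> ?t * ?L"
    proof -
      have "?t * ?L / (128 * ?a) \<le> ?t * ?L / 1"
        using a t L by (intro divide_left_mono) auto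
      then show ?thesis using n_upper by simp
    qed
    have quad: "?t / 2 * (?t / 2 - 1) / 2 \<ge> 0" using t by simp
    have expo: "?t powr (- (1/2)) \<le> exp (- (8 * p * (real n)\<^sup>2 / ?t\<^sup>2))"
    proof -
      have "8 * p * (real n)\<^sup>2 / ?t\<^sup>2 = 8 * (p * real n) * real n / ?t\<^sup>2"
        by (simp add: power2_eq_square)
      also have "\<dots> = 64 * ?a * real n / ?t"
        unfolding pn using t by (simp add: power2_eq_square field_simps)
      also have "\<dots> \<le> 64 * ?a * (?t * ?L / (128 * ?a)) / ?t"
        using n_upper a t by (intro divide_right_mono mult_left_mono) auto
      also have "\<dots> = ?L / 2" using a t by (simp add: field_simps)
      finally show ?thesis using t by (simp add: powr_def)
    qed
    have first: "real (t + 1) ^ n * exp (- (exp (- (8 * p * (real n)\<^sup>2 / ?t\<^sup>2)) * (?t / 2 * (?t / 2 - 1) / 2)))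
       \<le> exp (?t * ?L * ln (?t + 1) - ?t powr (- (1/2)) * (?t / 2 * (?t / 2 - 1) / 2))"
    proof -
      have "real (t + 1) ^ n = exp (real n * ln (?t + 1))"
        using t by (simp add: exp_of_nat_mult add.commute)
      also have "\<dots> \<le> exp (?t * ?L * ln (?t + 1))"
        using n_le t by (simp add: mult_right_mono)
      finally have *: "real (t + 1) ^ n \<le> exp (?t * ?L * ln (?t + 1))" .
      have "exp (- (exp (- (8 * p * (real n)\<^sup>2 / ?t\<^sup>2)) * (?t / 2 * (?t / 2 - 1) / 2)))
         \<le> exp (- (?t powr (- (1/2)) * (?t / 2 * (?t / 2 - 1) / 2)))"
        using mult_right_mono[OF expo quad] by simp
      with * have "real (t + 1) ^ n * exp (- (exp (- (8 * p * (real n)\<^sup>2 / ?t\<^sup>2)) * (?t / 2 * (?t / 2 - 1) / 2)))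
         \<le> exp (?t * ?L * ln (?t + 1)) * exp (- (?t powr (- (1/2)) * (?t / 2 * (?t / 2 - 1) / 2)))"
        by (intro mult_mono) auto
      then show ?thesis by (simp add: exp_add[symmetric])
    qed
    have second: "2 ^ n * 2 powr (- (?t\<^sup>2 / 2)) \<le> 2 powr (?t * ?L - ?t\<^sup>2 / 2)"
    proof -
      have "2 ^ n * 2 powr (- (?t\<^sup>2 / 2)) = 2 powr (real n - ?t\<^sup>2 / 2)"
        by (simp add: powr_realpow[symmetric] powr_add[symmetric])
      also have "\<dots> \<le> 2 powr (?t * ?L - ?t\<^sup>2 / 2)"
        using n_le by (intro powr_mono) auto
      finally show ?thesis .
    qed
    show ?case
    proof (intro exI[of _ n] exI[of _ p] conjI)
      show "real (t + 1) ^ n * exp (- (exp (- (8 * p * (real n)\<^sup>2 / ?t\<^sup>2)) * (?t / 2 * (?t / 2 - 1) / 2)))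
          + 2 ^ n * 2 powr (- (?t\<^sup>2 / 2)) < p / 2"
        using first second elim(3) p_lower by linarith
    qed (use elim n2 p0 p_half pn sparse in auto)
  qed
qed

theorem theorem1p5:
  fixes A :: nat
  assumes "A \<ge> 2"
  shows "\<exists>t\<^sub>A :: nat. \<forall>t :: nat. t \<ge> t\<^sub>A \<longrightarrow>
    (\<exists>G :: nat pair_pre_digraph.
       pair_graph G \<and> pverts G \<noteq> {} \<and>
       clique_minor_free t G \<and>
       graph_density G \<ge> real A * real t \<and>
       (\<forall>H :: nat pair_pre_digraph. simple_subgraph H G \<and> vertex_connected t H \<longrightarrow>
          real (num_vertices H) > 1 / (7200 * exp 1 * (real A)\<^sup>2) * (real t * ln (real t))))"
proof -
  obtain t\<^sub>A where parameters: "\<And>t. t \<ge> t\<^sub>A \<Longrightarrow> \<exists>n p. 2 \<le> t \<and> 2 \<le> n \<and> 0 < p \<and> p \<le> 1 / 2 \<and>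
    p * real n = 8 * real A * real t \<and>
    2 * exp 1 * (1 / (7200 * exp 1 * (real A)\<^sup>2) * (real t * ln (real t))) * p \<le> real t \<and>
    real (t + 1) ^ n * exp (- (exp (- (8 * p * (real n)\<^sup>2 / (real t)\<^sup>2)) *
        (real t / 2 * (real t / 2 - 1) / 2)))
      + 2 ^ n * 2 powr (- ((real t)\<^sup>2 / 2)) < p / 2"
    using parameters_eventually[OF assms] unfolding eventually_sequentially by blast
  show ?thesis
  proof (intro exI[of _ t\<^sub>A] allI impI)
    fix t :: nat
    assume "t \<ge> t\<^sub>A"
    let ?\<sigma> = "1 / (7200 * exp 1 * (real A)\<^sup>2) * (real t * ln (real t))"
    obtain n p where t: "2 \<le> t" and n: "2 \<le> n" and p: "0 < p" "p \<le> 1 / 2"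
      and pn: "p * real n = 8 * real A * real t"
      and sparse: "2 * exp 1 * ?\<sigma> * p \<le> real t"
      and total: "real (t + 1) ^ n * exp (- (exp (- (8 * p * (real n)\<^sup>2 / (real t)\<^sup>2)) *
          (real t / 2 * (real t / 2 - 1) / 2)))
        + 2 ^ n * 2 powr (- ((real t)\<^sup>2 / 2)) < p / 2"
      using parameters[OF \<open>t \<ge> t\<^sub>A\<close>] by blast
    obtain F where F: "F \<subseteq> edge_pairs {..<n}"
      and many: "p * real (n choose 2) / 2 \<le> real (card F)"
      and no_minor: "\<And>\<phi>. \<phi> \<in> {..<n} \<rightarrow>\<^sub>E {..t} \<Longrightarrow> \<exists>d\<in>edge_pairs {..<t}. \<forall>e\<in>F. \<phi> ` e \<noteq> d"
      and few: "\<And>X. X \<subseteq> {..<n} \<Longrightarrow> t < card X \<Longrightarrow> real (card X) \<le> ?\<sigma> \<Longrightarrow>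
          2 * card (F \<inter> edge_pairs X) < t * card X"
      using exists_good_edge_set[of "{..<n}" t p ?\<sigma>] t n p sparse total
      unfolding card_lessThan by (metis finite_lessThan)
    let ?G = "graph_on {..<n} F"
    have "real A * real t \<le> graph_density ?G"
    proof -
      have "2 * (real A * real t) * real n \<le> 4 * (real A * real t) * (real n - 1)"
      proof -
        have "(real A * real t) * (2 * real n) \<le> (real A * real t) * (4 * (real n - 1))"
          using n by (intro mult_left_mono) auto
        then show ?thesis by (simp add: mult_ac)
      qed
      also have "\<dots> = (p * real n) * (real n - 1) / 2" by (simp add: pn)
      also have "\<dots> = 2 * (p * real (n choose 2) / 2)"
        by (simp add: real_choose_two)
      also have "\<dots> \<le> 2 * real (card F)" using many by simp
      finally have "real A * real t * real n \<le> real (card F)" by simp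
      then show ?thesis
        using n F by (simp add: graph_density_def num_edges_graph_on num_vertices_def field_simps)
    qed
    moreover have "?\<sigma> < real (num_vertices H)"
      if H: "simple_subgraph H ?G" "vertex_connected t H" for H
    proof (rule ccontr)
      assume small: "\<not> ?\<sigma> < real (num_vertices H)"
      note sub = simple_subgraph_graph_on[OF H(1) F]
      have "t * card (pverts H) \<le> 2 * num_edges H"
        using vertex_connected_num_edges[OF _ H(2)] H(1) by (simp add: simple_subgraph_def num_vertices_def)
      also have "\<dots> \<le> 2 * card (F \<inter> edge_pairs (pverts H))"
        unfolding num_edges_def using sub(2) finite_subset[OF F]
        by (intro mult_le_mono2 card_mono) auto
      also have "\<dots> < t * card (pverts H)"
        using few[OF sub(1)] small H(2) by (simp add: num_vertices_def vertex_connected_def)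
      finally show False by simp
    qed
    moreover have "pair_graph ?G" using F by (intro pair_graph_graph_on) auto
    moreover have "pverts ?G \<noteq> {}" using n by (auto simp: lessThan_empty_iff)
    moreover have "clique_minor_free t ?G" using no_minor by (rule clique_minor_free_graph_on)
    ultimately show "\<exists>G :: nat pair_pre_digraph.
       pair_graph G \<and> pverts G \<noteq> {} \<and>
       clique_minor_free t G \<and>
       graph_density G \<ge> real A * real t \<and>
       (\<forall>H :: nat pair_pre_digraph. simple_subgraph H G \<and> vertex_connected t H \<longrightarrow>
          real (num_vertices H) > ?\<sigma>)"
      by blast
  qed
qed

end
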